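(* Let $g:\,]0,T]\times\Omega\to\mathbb{R}$ be a progressively measurable function, $\rho\in\mathcal{K}$, and let $g^{*,\rho}$ be defined as in the context. Let $Y\in\mathcal{D}$. Then $$g(t,\omega)\le Y_{t-}(\omega)\quad d\rho_t(\omega)P(d\omega)\text{-a.e.}$$ if and only if $$\text{for } P\text{-almost every }\omega:\quad \forall t\in\,]0,T],\quad g^{*,\rho}(t,\omega)\le Y_{t-}(\omega).$$
   Context: $T>0$; $(\mathcal{F}_t)_{t\le T}$ is the standard augmentation of the filtration of a Brownian motion on a probability space $(\Omega,\mathcal{F},P)$. $\mathcal{P}$ is the predictable $\sigma$-algebra on $[0,T]\times\Omega$. $\mathcal{D}$ is the set of real-valued $\mathcal{P}$-measurable right-continuous processes with left limits on $[0,T]$; $Y_{t-}=\lim_{s\nearrow t}Y_s$. $\mathcal{K}$ is the set of nondecreasing $K\in\mathcal{D}$ with $K_0=0$. Integrals $\int_0^t\cdot\,d\rho_s$ are over $]0,t]$. For $(t,\omega)\in[0,T]\times\Omega$ and $n\in\mathbb{N}$, $$g^{n,\rho}(t,\omega)=-nt+\inf\Big\{a\in\mathbb{R}:\int_0^t[g(s,\omega)+ns-a]^+d\rho_s(\omega)=0\Big\},\qquad g^{*,\rho}(t,\omega)=\inf_n g^{n,\rho}(t,\omega),$$ with values in $[-\infty,+\infty]$. *)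

theory Defs
  imports "HOL-Probability.Probability"
begin

text \<open>Processes are curried, \<open>X t \<omega>\<close>; only their values for times in \<open>[0,T]\<close> (or \<open>]0,T]\<close>) matter.\<close>

subsection \<open>The augmented Brownian filtration\<close>

definition natural_filtration ::
    "'a measure \<Rightarrow> (real \<Rightarrow> 'a \<Rightarrow> 'b::topological_space) \<Rightarrow> real \<Rightarrow> 'a measure" where
  "natural_filtration M B t =
     sigma (space M) (\<Union>s\<in>{0..t}. {B s -` C \<inter> space M | C. C \<in> sets borel})"

text \<open>Standard Brownian motion on \<open>[0,T]\<close>, started at 0, of arbitrary finite dimension;
  \<open>'b = real\<close> is the one-dimensional case. The second parameter of \<^const>\<open>normal_density\<close> is the
  standard deviation.\<close>

definition brownian_motion ::
    "'a measure \<Rightarrow> real \<Rightarrow> (real \<Rightarrow> 'a \<Rightarrow> 'b::euclidean_space) \<Rightarrow> bool" where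
  "brownian_motion M T B \<longleftrightarrow>
     (\<forall>t\<in>{0..T}. B t \<in> borel_measurable M) \<and>
     (AE \<omega> in M. B 0 \<omega> = 0) \<and>
     (AE \<omega> in M. continuous_on {0..T} (\<lambda>t. B t \<omega>)) \<and>
     (\<forall>s t. 0 \<le> s \<and> s < t \<and> t \<le> T \<longrightarrow>
        prob_space.indep_set M (sets (natural_filtration M B s))
          {(\<lambda>\<omega>. B t \<omega> - B s \<omega>) -` C \<inter> space M | C. C \<in> sets borel} \<and>
        prob_space.indep_vars M (\<lambda>_. borel) (\<lambda>b \<omega>. (B t \<omega> - B s \<omega>) \<bullet> b) Basis \<and>
        (\<forall>b\<in>Basis. distributed M lborel (\<lambda>\<omega>. (B t \<omega> - B s \<omega>) \<bullet> b)
           (normal_density 0 (sqrt (t - s)))))"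

text \<open>The null sets of the completion are all subsets of \<open>P\<close>-null sets, so the \<open>\<sigma>\<close>-algebras below
  lie in the completed \<open>\<sigma>\<close>-algebra \<open>sets (completion M)\<close>, not in \<open>sets M\<close>. Like
  \<^const>\<open>natural_filtration\<close>, they carry no measure: only their \<open>\<sigma>\<close>-algebras are used.\<close>

definition augmented_filtration ::
    "'a measure \<Rightarrow> (real \<Rightarrow> 'a \<Rightarrow> 'b::topological_space) \<Rightarrow> real \<Rightarrow> 'a measure" where
  "augmented_filtration M B t =
     sigma (space M) (sets (natural_filtration M B t) \<union> null_sets (completion M))"

subsection \<open>Predictable and progressively measurable processes\<close>

definition predictable_algebra :: "real \<Rightarrow> (real \<Rightarrow> 'a measure) \<Rightarrow> (real \<times> 'a) measure" where
  "predictable_algebra T F =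
     sigma ({0..T} \<times> space (F 0))
       ({{0} \<times> A | A. A \<in> sets (F 0)} \<union>
        {{s<..t} \<times> A | s t A. 0 \<le> s \<and> s < t \<and> t \<le> T \<and> A \<in> sets (F s)})"

definition progressively_measurable ::
    "real \<Rightarrow> (real \<Rightarrow> 'a measure) \<Rightarrow> (real \<Rightarrow> 'a \<Rightarrow> real) \<Rightarrow> bool" where
  "progressively_measurable T F g \<longleftrightarrow>
     (\<forall>t\<in>{0<..T}. (\<lambda>(s, \<omega>). g s \<omega>) \<in> borel_measurable (restrict_space borel {0<..t} \<Otimes>\<^sub>M F t))"

definition cadlag :: "real \<Rightarrow> (real \<Rightarrow> real) \<Rightarrow> bool" where
  "cadlag T x \<longleftrightarrow>
     (\<forall>t\<in>{0..<T}. continuous (at_right t) x) \<and> (\<forall>t\<in>{0<..T}. \<exists>l. (x \<longlongrightarrow> l) (at_left t))"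

definition left_limit :: "(real \<Rightarrow> real) \<Rightarrow> real \<Rightarrow> real" where
  "left_limit x t = Lim (at_left t) x"

definition class_D :: "real \<Rightarrow> (real \<Rightarrow> 'a measure) \<Rightarrow> (real \<Rightarrow> 'a \<Rightarrow> real) set" where
  "class_D T F =
     {X. (\<lambda>(t, \<omega>). X t \<omega>) \<in> borel_measurable (predictable_algebra T F) \<and>
         (\<forall>\<omega>\<in>space (F 0). cadlag T (\<lambda>t. X t \<omega>))}"

definition class_K :: "real \<Rightarrow> (real \<Rightarrow> 'a measure) \<Rightarrow> (real \<Rightarrow> 'a \<Rightarrow> real) set" where
  "class_K T F =
     {K \<in> class_D T F. \<forall>\<omega>\<in>space (F 0). mono_on {0..T} (\<lambda>t. K t \<omega>) \<and> K 0 \<omega> = 0}"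

subsection \<open>The measures \<open>d\<rho>\<^sub>t(\<omega>)\<close> and \<open>d\<rho>\<^sub>t(\<omega>)P(d\<omega>)\<close>\<close>

text \<open>A path is extended to the real line by its values at 0 and \<open>T\<close>, so its Stieltjes measure is
  concentrated on \<open>]0,T]\<close>.\<close>

definition stieltjes :: "real \<Rightarrow> (real \<Rightarrow> 'a \<Rightarrow> real) \<Rightarrow> 'a \<Rightarrow> real measure" where
  "stieltjes T \<rho> \<omega> = interval_measure (\<lambda>t. \<rho> (max 0 (min T t)) \<omega>)"

text \<open>Since \<open>\<rho>\<^sub>t\<close> is measurable only for the completed \<open>\<sigma>\<close>-algebra, the product is taken with
  \<open>completion M\<close>.\<close>

definition stieltjes_product ::
    "'a measure \<Rightarrow> real \<Rightarrow> (real \<Rightarrow> 'a \<Rightarrow> real) \<Rightarrow> (real \<times> 'a) measure" where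
  "stieltjes_product M T \<rho> =
     measure_of (UNIV \<times> space M) (sets (borel \<Otimes>\<^sub>M completion M))
       (\<lambda>A. \<integral>\<^sup>+\<omega>. emeasure (stieltjes T \<rho> \<omega>) {t. (t, \<omega>) \<in> A} \<partial>completion M)"

subsection \<open>The functions \<open>g\<^sup>n\<^sup>,\<^sup>\<rho>\<close> and \<open>g\<^sup>*\<^sup>,\<^sup>\<rho>\<close>\<close>

text \<open>The infimum is taken in the extended reals, hence it is \<open>\<infinity>\<close> for the empty set.\<close>

definition g_level ::
    "real \<Rightarrow> (real \<Rightarrow> 'a \<Rightarrow> real) \<Rightarrow> (real \<Rightarrow> 'a \<Rightarrow> real) \<Rightarrow> nat \<Rightarrow> real \<Rightarrow> 'a \<Rightarrow> ereal" where
  "g_level T \<rho> g n t \<omega> =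
     - ereal (real n * t) +
     Inf (ereal ` {a. (\<integral>\<^sup>+s\<in>{0<..t}. ennreal (max 0 (g s \<omega> + real n * s - a)) \<partial>stieltjes T \<rho> \<omega>) = 0})"

definition g_star ::
    "real \<Rightarrow> (real \<Rightarrow> 'a \<Rightarrow> real) \<Rightarrow> (real \<Rightarrow> 'a \<Rightarrow> real) \<Rightarrow> real \<Rightarrow> 'a \<Rightarrow> ereal" where
  "g_star T \<rho> g t \<omega> = (INF n. g_level T \<rho> g n t \<omega>)"

subsection \<open>The product measure has the intended values\<close>

text \<open>\<^const>\<open>measure_of\<close> returns the zero measure when the given set function is not a measure;
  the following facts rule this out for \<open>\<rho>\<close> in \<open>\<K>\<close>.\<close>

lemma space_augmented_filtration [simp]: "space (augmented_filtration M B t) = space M"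
  unfolding augmented_filtration_def by (simp add: space_measure_of_conv)

lemma sets_natural_filtration_subset:
  assumes "\<And>s. s \<in> {0..t} \<Longrightarrow> B s \<in> borel_measurable M"
  shows "sets (natural_filtration M B t) \<subseteq> sets M"
proof -
  have "(\<Union>s\<in>{0..t}. {B s -` C \<inter> space M | C. C \<in> sets borel}) \<subseteq> sets M"
    using assms by (auto intro: measurable_sets)
  then show ?thesis
    unfolding natural_filtration_def
    by (subst sets_measure_of) (auto dest: sets.sets_into_space intro!: sets.sigma_sets_subset)
qed

lemma sets_augmented_filtration_subset:
  assumes "\<And>s. s \<in> {0..t} \<Longrightarrow> B s \<in> borel_measurable M"
  shows "sets (augmented_filtration M B t) \<subseteq> sets (completion M)"
proof -
  have "sets (natural_filtration M B t) \<subseteq> sets (completion M)"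
    using sets_natural_filtration_subset[of t B M] assms by (blast intro: sets_completionI_sets)
  then have *: "sets (natural_filtration M B t) \<union> null_sets (completion M) \<subseteq> sets (completion M)"
    by (auto intro: null_setsD2)
  also have "\<dots> \<subseteq> Pow (space M)"
    using sets.space_closed[of "completion M"] by simp
  finally show ?thesis
    unfolding augmented_filtration_def
    using sets.sigma_sets_subset[OF *] by (simp add: sets_measure_of)
qed

lemma class_D_measurable:
  assumes bm: "brownian_motion M T B" and X: "X \<in> class_D T (augmented_filtration M B)"
    and t: "t \<in> {0..T}"
  shows "X t \<in> borel_measurable (completion M)"
proof -
  let ?F = "augmented_filtration M B" and ?N = "completion M"
  let ?G = "{{0} \<times> A | A. A \<in> sets (?F 0)} \<union>
        {{s<..t} \<times> A | s t A. 0 \<le> s \<and> s < t \<and> t \<le> T \<and> A \<in> sets (?F s)}"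
  have sub: "sets (?F s) \<subseteq> sets ?N" if "s \<le> T" for s
    using bm that by (intro sets_augmented_filtration_subset) (auto simp: brownian_motion_def)
  have G: "?G \<subseteq> Pow ({0..T} \<times> space M)"
    using sets.sets_into_space[of _ "?F _"] t by fastforce
  have "(\<lambda>\<omega>. (t, \<omega>)) \<in> measurable ?N (predictable_algebra T ?F)"
    unfolding predictable_algebra_def space_augmented_filtration
  proof (rule measurable_measure_of[OF G])
    show "(\<lambda>\<omega>. (t, \<omega>)) \<in> space ?N \<rightarrow> {0..T} \<times> space M" using t by auto
  next
    fix A assume "A \<in> ?G"
    then have "(\<exists>C. A = {0} \<times> C \<and> C \<in> sets ?N) \<or> (\<exists>a b C. A = {a<..b} \<times> C \<and> C \<in> sets ?N)"
    proof
      assume "A \<in> {{0} \<times> A | A. A \<in> sets (?F 0)}"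
      then show ?thesis using sub[of 0] t by auto
    next
      assume "A \<in> {{s<..t} \<times> A | s t A. 0 \<le> s \<and> s < t \<and> t \<le> T \<and> A \<in> sets (?F s)}"
      then obtain a b C where "A = {a<..b} \<times> C" "a \<le> T" "C \<in> sets (?F a)" by auto
      with sub[of a] show ?thesis by blast
    qed
    then consider (zero) C where "A = {0} \<times> C" "C \<in> sets ?N"
      | (ioc) a b C where "A = {a<..b} \<times> C" "C \<in> sets ?N"
      by blast
    then show "(\<lambda>\<omega>. (t, \<omega>)) -` A \<inter> space ?N \<in> sets ?N"
    proof cases
      case zero
      then have "(\<lambda>\<omega>. (t, \<omega>)) -` A \<inter> space ?N = (if t = 0 then C else {})"
        using sets.sets_into_space[OF zero(2)] by auto
      with zero show ?thesis by simp
    next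
      case ioc
      then have "(\<lambda>\<omega>. (t, \<omega>)) -` A \<inter> space ?N = (if t \<in> {a<..b} then C else {})"
        using sets.sets_into_space[OF ioc(2)] by auto
      with ioc show ?thesis by simp
    qed
  qed
  from measurable_compose[OF this, of "\<lambda>(t, \<omega>). X t \<omega>" borel] X show ?thesis
    by (simp add: class_D_def)
qed

lemma emeasure_stieltjes_Ioc:
  assumes T: "0 \<le> T" and mono: "mono_on {0..T} (\<lambda>t. \<rho> t \<omega>)" and cad: "cadlag T (\<lambda>t. \<rho> t \<omega>)"
    and ab: "a \<le> b"
  shows "emeasure (stieltjes T \<rho> \<omega>) {a<..b}
         = ennreal (\<rho> (max 0 (min T b)) \<omega> - \<rho> (max 0 (min T a)) \<omega>)"
  unfolding stieltjes_def
proof (rule emeasure_interval_measure_Ioc[OF ab])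
  fix x y :: real assume "x \<le> y"
  then show "\<rho> (max 0 (min T x)) \<omega> \<le> \<rho> (max 0 (min T y)) \<omega>"
    using T by (intro mono_onD[OF mono]) auto
next
  fix a :: real
  let ?c = "\<lambda>t. max 0 (min T t)"
  consider "a < 0" | "0 \<le> a" "a < T" | "T \<le> a" by linarith
  then show "continuous (at_right a) (\<lambda>t. \<rho> (?c t) \<omega>)"
  proof cases
    case 1
    have "eventually (\<lambda>t. \<rho> (?c t) \<omega> = \<rho> (?c a) \<omega>) (at_right a)"
      using eventually_at_right_real[OF 1] by eventually_elim (use 1 T in auto)
    then show ?thesis by (simp add: continuous_within tendsto_eventually)
  next
    case 2
    have ev: "eventually (\<lambda>t. \<rho> t \<omega> = \<rho> (?c t) \<omega>) (at_right a)"
      using eventually_at_right_real[OF 2(2)] by eventually_elim (use 2 in auto)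
    have "((\<lambda>t. \<rho> t \<omega>) \<longlongrightarrow> \<rho> a \<omega>) (at_right a)"
      using cad 2 by (auto simp: cadlag_def continuous_within)
    then have "((\<lambda>t. \<rho> (?c t) \<omega>) \<longlongrightarrow> \<rho> a \<omega>) (at_right a)"
      using tendsto_cong[OF ev] by blast
    then show ?thesis using 2 by (simp add: continuous_within)
  next
    case 3
    have "eventually (\<lambda>t. \<rho> (?c t) \<omega> = \<rho> (?c a) \<omega>) (at_right a)"
      using eventually_at_right_less[of a] by eventually_elim (use 3 T in auto)
    then show ?thesis by (simp add: continuous_within tendsto_eventually)
  qed
qed

lemma UN_symmetric_Ioc: "(\<Union>n. {- real n<..real n}) = UNIV"
proof -
  have "\<exists>n. - real n < x \<and> x \<le> real n" for x :: real
  proof -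
    obtain n where "\<bar>x\<bar> < real n" using reals_Archimedean2 by blast
    then have "- real n < x \<and> x \<le> real n" by linarith
    then show ?thesis ..
  qed
  then show ?thesis by auto
qed

lemma finite_measure_stieltjes:
  assumes T: "0 \<le> T" and mono: "mono_on {0..T} (\<lambda>t. \<rho> t \<omega>)" and cad: "cadlag T (\<lambda>t. \<rho> t \<omega>)"
  shows "finite_measure (stieltjes T \<rho> \<omega>)"
proof (rule finite_measureI)
  let ?S = "stieltjes T \<rho> \<omega>"
  have "(\<lambda>n. emeasure ?S {- real n<..real n}) \<longlonglongrightarrow> emeasure ?S (\<Union>n. {- real n<..real n})"
    by (rule Lim_emeasure_incseq) (auto simp: stieltjes_def incseq_def)
  then have "(\<lambda>n. emeasure ?S {- real n<..real n}) \<longlonglongrightarrow> emeasure ?S UNIV"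
    by (simp add: UN_symmetric_Ioc)
  moreover have "emeasure ?S {- real n<..real n} \<le> ennreal (\<rho> T \<omega> - \<rho> 0 \<omega>)" for n
    using T by (subst emeasure_stieltjes_Ioc[of T \<rho> \<omega>, OF T mono cad])
      (auto intro!: ennreal_leI diff_mono mono_onD[OF mono])
  ultimately have "emeasure ?S UNIV \<le> ennreal (\<rho> T \<omega> - \<rho> 0 \<omega>)"
    by (intro LIMSEQ_le_const2) auto
  then show "emeasure ?S (space ?S) \<noteq> \<infinity>"
    by (auto simp: stieltjes_def top_unique)
qed

lemma measurable_stieltjes_slice:
  assumes T: "0 \<le> T"
    and mono: "\<And>\<omega>. \<omega> \<in> space N \<Longrightarrow> mono_on {0..T} (\<lambda>t. \<rho> t \<omega>)"
    and cad: "\<And>\<omega>. \<omega> \<in> space N \<Longrightarrow> cadlag T (\<lambda>t. \<rho> t \<omega>)"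
    and meas: "\<And>t. t \<in> {0..T} \<Longrightarrow> \<rho> t \<in> borel_measurable N"
    and A: "A \<in> sets (borel \<Otimes>\<^sub>M N)"
  shows "(\<lambda>\<omega>. emeasure (stieltjes T \<rho> \<omega>) {t. (t, \<omega>) \<in> A}) \<in> borel_measurable N"
proof -
  let ?S = "stieltjes T \<rho>"
  let ?I = "range (\<lambda>(a, b). {a<..b::real})"
  let ?E = "{a \<times> b | a b. a \<in> ?I \<and> b \<in> sets N}"
  have slice: "{t. (t, \<omega>) \<in> A} \<in> sets borel" if "A \<in> sets (borel \<Otimes>\<^sub>M N)" for A \<omega>
    using sets_Pair2[OF that, of \<omega>] by (simp add: vimage_def)
  have gen: "sets (borel \<Otimes>\<^sub>M N) = sigma_sets (UNIV \<times> space N) ?E"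
  proof -
    have "sets (borel \<Otimes>\<^sub>M N) = sets (sigma (space borel \<times> space N) ?E)"
    proof (rule sets_pair_eq[where Ca = "range (\<lambda>n::nat. {- real n<..real n})" and Cb = "{space N}"])
      show "(sets borel :: real set set) = sigma_sets (space borel) ?I"
        by (subst borel_sigma_sets_Ioc) (simp add: space_borel)
      show "\<Union> (range (\<lambda>n::nat. {- real n<..real n})) = space borel"
        by (simp add: UN_symmetric_Ioc)
    qed (auto dest: sets.sets_into_space simp: sets.sigma_sets_eq)
    then show ?thesis
      by (subst (asm) sets_measure_of) (auto dest: sets.sets_into_space)
  qed
  have int: "Int_stable ?E"
  proof (rule Int_stableI)
    fix X Y assume "X \<in> ?E" "Y \<in> ?E"
    then obtain a b C c d D where "X = {a<..b} \<times> C" "Y = {c<..d} \<times> D" "C \<in> sets N" "D \<in> sets N"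
      by auto
    then have "X \<inter> Y = {max a c<..min b d} \<times> (C \<inter> D)" "C \<inter> D \<in> sets N" by auto
    then show "X \<inter> Y \<in> ?E" by blast
  qed
  have pow: "?E \<subseteq> Pow (UNIV \<times> space N)" by (auto dest: sets.sets_into_space)
  from A have "A \<in> sigma_sets (UNIV \<times> space N) ?E" by (simp add: gen)
  from int pow this show ?thesis
  proof (induct rule: sigma_sets_induct_disjoint)
    case (basic A)
    then obtain a b C where A: "A = {a<..b} \<times> C" "C \<in> sets N" by auto
    have *: "{t. (t, \<omega>) \<in> A} = (if \<omega> \<in> C then {a<..b} else {})" for \<omega> using A by auto
    show ?case
    proof (cases "a \<le> b")
      case True
      have "(\<lambda>\<omega>. indicator C \<omega> * ennreal (\<rho> (max 0 (min T b)) \<omega> - \<rho> (max 0 (min T a)) \<omega>))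
            \<in> borel_measurable N"
        using T A by (auto intro!: borel_measurable_times_ennreal measurable_compose[OF _ measurable_ennreal]
            borel_measurable_diff meas)
      then show ?thesis
        by (rule measurable_cong[THEN iffD1, rotated])
          (auto simp: * emeasure_stieltjes_Ioc[OF T mono cad True])
    next
      case False
      then have "{t. (t, \<omega>) \<in> A} = {}" for \<omega> using A by auto
      then show ?thesis by simp
    qed
  next
    case empty
    then show ?case by simp
  next
    case (compl A)
    have "(\<lambda>\<omega>. emeasure (?S \<omega>) UNIV) \<in> borel_measurable N"
    proof -
      have lim: "(\<lambda>n. emeasure (?S \<omega>) {- real n<..real n}) \<longlonglongrightarrow> emeasure (?S \<omega>) UNIV" for \<omega>
      proof -
        have "(\<lambda>n. emeasure (?S \<omega>) {- real n<..real n})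
              \<longlonglongrightarrow> emeasure (?S \<omega>) (\<Union>n. {- real n<..real n})"
          by (rule Lim_emeasure_incseq) (auto simp: stieltjes_def incseq_def)
        then show ?thesis by (simp add: UN_symmetric_Ioc)
      qed
      have "(\<lambda>\<omega>. emeasure (?S \<omega>) {- real n<..real n}) \<in> borel_measurable N" for n
      proof -
        have "(\<lambda>\<omega>. ennreal (\<rho> (max 0 (min T (real n))) \<omega> - \<rho> (max 0 (min T (- real n))) \<omega>))
              \<in> borel_measurable N"
          using T by (auto intro!: measurable_compose[OF _ measurable_ennreal]
              borel_measurable_diff meas)
        then show ?thesis
          by (rule measurable_cong[THEN iffD1, rotated]) (simp add: emeasure_stieltjes_Ioc[OF T mono cad])
      qed
      then show ?thesis by (rule borel_measurable_LIMSEQ_order[rotated]) (rule lim)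
    qed
    with compl have "(\<lambda>\<omega>. emeasure (?S \<omega>) UNIV - emeasure (?S \<omega>) {t. (t, \<omega>) \<in> A})
        \<in> borel_measurable N"
      by (intro borel_measurable_minus_ennreal)
    then show ?case
    proof (rule measurable_cong[THEN iffD1, rotated])
      fix \<omega> assume \<omega>: "\<omega> \<in> space N"
      interpret finite_measure "?S \<omega>"
        by (rule finite_measure_stieltjes[of T \<rho> \<omega>, OF T mono[OF \<omega>] cad[OF \<omega>]])
      have A: "{t. (t, \<omega>) \<in> A} \<in> sets (?S \<omega>)"
        using compl slice[of A \<omega>] by (simp add: stieltjes_def gen)
      have "{t. (t, \<omega>) \<in> UNIV \<times> space N - A} = space (?S \<omega>) - {t. (t, \<omega>) \<in> A}"
        using \<omega> by (auto simp: stieltjes_def)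
      then show "emeasure (?S \<omega>) UNIV - emeasure (?S \<omega>) {t. (t, \<omega>) \<in> A}
          = emeasure (?S \<omega>) {t. (t, \<omega>) \<in> UNIV \<times> space N - A}"
        using emeasure_compl[OF A] emeasure_finite[of "{t. (t, \<omega>) \<in> A}"]
        by (simp only: infinity_ennreal_def) (simp add: stieltjes_def)
    qed
  next
    case (union A)
    have "(\<lambda>\<omega>. \<Sum>i. emeasure (?S \<omega>) {t. (t, \<omega>) \<in> A i}) \<in> borel_measurable N"
      by (rule borel_measurable_suminf_order) (rule union)
    then show ?case
    proof (rule measurable_cong[THEN iffD1, rotated])
      fix \<omega>
      have "A i \<in> sets (borel \<Otimes>\<^sub>M N)" for i
        using union(2) by (auto simp: gen)
      then have "{t. (t, \<omega>) \<in> A i} \<in> sets (?S \<omega>)" for i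
        using slice[of "A i" \<omega>] by (simp add: stieltjes_def)
      then have "(\<Sum>i. emeasure (?S \<omega>) {t. (t, \<omega>) \<in> A i})
          = emeasure (?S \<omega>) (\<Union>i. {t. (t, \<omega>) \<in> A i})"
        using union(1) by (intro suminf_emeasure) (auto simp: disjoint_family_on_def set_eq_iff)
      also have "(\<Union>i. {t. (t, \<omega>) \<in> A i}) = {t. (t, \<omega>) \<in> \<Union> (range A)}" by auto
      finally show "(\<Sum>i. emeasure (?S \<omega>) {t. (t, \<omega>) \<in> A i})
          = emeasure (?S \<omega>) {t. (t, \<omega>) \<in> \<Union> (range A)}" .
    qed
  qed
qed

lemma emeasure_stieltjes_product:
  assumes T: "0 \<le> T" and bm: "brownian_motion M T B"
    and \<rho>: "\<rho> \<in> class_K T (augmented_filtration M B)"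
    and A: "A \<in> sets (borel \<Otimes>\<^sub>M completion M)"
  shows "emeasure (stieltjes_product M T \<rho>) A
         = (\<integral>\<^sup>+\<omega>. emeasure (stieltjes T \<rho> \<omega>) {t. (t, \<omega>) \<in> A} \<partial>completion M)"
proof -
  let ?N = "completion M" and ?S = "stieltjes T \<rho>"
  let ?\<mu> = "\<lambda>A. \<integral>\<^sup>+\<omega>. emeasure (?S \<omega>) {t. (t, \<omega>) \<in> A} \<partial>?N"
  have D: "\<rho> \<in> class_D T (augmented_filtration M B)" using \<rho> by (simp add: class_K_def)
  have meas: "(\<lambda>\<omega>. emeasure (?S \<omega>) {t. (t, \<omega>) \<in> A}) \<in> borel_measurable ?N"
    if "A \<in> sets (borel \<Otimes>\<^sub>M ?N)" for A
    using \<rho> class_D_measurable[OF bm D] that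
    by (intro measurable_stieltjes_slice[OF T]) (auto simp: class_K_def class_D_def)
  have ca: "countably_additive (sets (borel \<Otimes>\<^sub>M ?N)) ?\<mu>"
  proof (rule countably_additiveI)
    fix A :: "nat \<Rightarrow> (real \<times> 'a) set"
    assume A: "range A \<subseteq> sets (borel \<Otimes>\<^sub>M ?N)" "disjoint_family A"
    have "(\<Sum>i. ?\<mu> (A i)) = (\<integral>\<^sup>+\<omega>. (\<Sum>i. emeasure (?S \<omega>) {t. (t, \<omega>) \<in> A i}) \<partial>?N)"
      using A by (intro nn_integral_suminf[symmetric] meas) auto
    also have "\<dots> = ?\<mu> (\<Union>i. A i)"
    proof (rule nn_integral_cong)
      fix \<omega>
      have "{t. (t, \<omega>) \<in> A i} \<in> sets (?S \<omega>)" for i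
        using sets_Pair2[of "A i" borel ?N \<omega>] A by (auto simp: vimage_def stieltjes_def)
      then have "(\<Sum>i. emeasure (?S \<omega>) {t. (t, \<omega>) \<in> A i}) = emeasure (?S \<omega>) (\<Union>i. {t. (t, \<omega>) \<in> A i})"
        using A by (intro suminf_emeasure) (auto simp: disjoint_family_on_def set_eq_iff)
      also have "(\<Union>i. {t. (t, \<omega>) \<in> A i}) = {t. (t, \<omega>) \<in> (\<Union>i. A i)}" by auto
      finally show "(\<Sum>i. emeasure (?S \<omega>) {t. (t, \<omega>) \<in> A i})
          = emeasure (?S \<omega>) {t. (t, \<omega>) \<in> (\<Union>i. A i)}" .
    qed
    finally show "(\<Sum>i. ?\<mu> (A i)) = ?\<mu> (\<Union>i. A i)" .
  qed
  have sig: "sets (stieltjes_product M T \<rho>) = sets (borel \<Otimes>\<^sub>M ?N)"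
    unfolding stieltjes_product_def
    using sets.space_closed[of "borel \<Otimes>\<^sub>M ?N"] sets.sigma_sets_eq[of "borel \<Otimes>\<^sub>M ?N"]
    by (subst sets_measure_of) (auto simp: space_pair_measure)
  show ?thesis
  proof (rule emeasure_measure_of[OF stieltjes_product_def])
    show "sets (borel \<Otimes>\<^sub>M ?N) \<subseteq> Pow (UNIV \<times> space M)"
      using sets.space_closed[of "borel \<Otimes>\<^sub>M ?N"] by (simp add: space_pair_measure)
    show "A \<in> sets (stieltjes_product M T \<rho>)" using A sig by simp
    show "positive (sets (stieltjes_product M T \<rho>)) ?\<mu>" by (simp add: positive_def)
    show "countably_additive (sets (stieltjes_product M T \<rho>)) ?\<mu>" using ca sig by simp
  qed
qed

end

theory Submission
  imports Defs
begin

text \<open>The equivalence holds path by path. Up to the shift by \<open>-nt\<close>, \<open>g\<^sup>n\<^sup>,\<^sup>\<rho>\<close> is the running essential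
  supremum of \<open>g(s) + ns\<close>, and a function is a.e. below its running essential supremum, so
  \<open>g \<le> g\<^sup>*\<^sup>,\<^sup>\<rho>\<close> holds \<open>d\<rho>\<close>-a.e. Conversely, if \<open>g(s) \<le> Y\<^sub>s\<^sub>-\<close> a.e., then \<open>g\<^sup>n\<^sup>,\<^sup>\<rho>(t)\<close> is at most the
  supremum of \<open>Y\<^sub>s\<^sub>- - n(t - s)\<close> over \<open>s \<le> t\<close>; since \<open>Y\<^sub>-\<close> is bounded and left-continuous, the penalty
  \<open>n(t - s)\<close> localises this supremum at \<open>t\<close> as \<open>n\<close> grows.\<close>

subsection \<open>Left limits of cadlag paths\<close>

lemma tendsto_left_limit:
  assumes "cadlag T x" "t \<in> {0<..T}"
  shows "(x \<longlongrightarrow> left_limit x t) (at_left t)"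
proof -
  obtain l where l: "(x \<longlongrightarrow> l) (at_left t)"
    using assms unfolding cadlag_def by blast
  then have "left_limit x t = l"
    unfolding left_limit_def by (intro tendsto_Lim) auto
  with l show ?thesis by simp
qed

text \<open>Right-continuity and the left limit bound \<open>x\<close> on either side of each point,
  so \<open>x\<close> is bounded above near every point; bisection glues the local bounds into
  one.\<close>

lemma cadlag_bounded_above:
  assumes "cadlag T x" "0 \<le> T"
  shows "\<exists>C. \<forall>t\<in>{0..T}. x t \<le> C"
proof -
  \<comment> \<open>The local condition of \<open>Bolzano\<close> ranges over all small intervals
    around a point, including those that leave \<open>{0..T}\<close>; the intersection lets these
    pass.\<close>
  let ?P = "\<lambda>a b. \<exists>C. \<forall>t\<in>{a..b}\<inter>{0..T}. x t \<le> C"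
  have "?P 0 T"
  proof (rule Bolzano[where P = ?P, OF assms(2)])
    fix a b c :: real
    assume "?P a b" "?P b c"
    then obtain C D where "\<forall>t\<in>{a..b}\<inter>{0..T}. x t \<le> C" "\<forall>t\<in>{b..c}\<inter>{0..T}. x t \<le> D" by auto
    then have "\<forall>t\<in>{a..c}\<inter>{0..T}. x t \<le> max C D"
      by (metis IntE IntI atLeastAtMost_iff linear max.coboundedI1 max.coboundedI2)
    then show "?P a c" by blast
  next
    fix t assume t: "0 \<le> t" "t \<le> T"
    have "\<exists>b>t. \<forall>s\<in>{t<..<b}\<inter>{0..T}. x s \<le> x t + 1"
    proof (cases "t < T")
      case True
      then have "(x \<longlongrightarrow> x t) (at_right t)"
        using assms(1) t by (auto simp: cadlag_def continuous_within)
      then have "eventually (\<lambda>s. x s < x t + 1) (at_right t)" by (rule order_tendstoD) simp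
      then show ?thesis unfolding eventually_at_right_field by fastforce
    next
      case False
      \<comment> \<open>Here \<open>t = T\<close>, so no point of \<open>{0..T}\<close> lies to the
        right and any bound is vacuous; the same happens on the left for
        \<open>t = 0\<close>.\<close>
      then have "\<forall>s\<in>{t<..<t+1}\<inter>{0..T}. x s \<le> x t + 1" by auto
      then show ?thesis by (intro exI[of _ "t+1"]) auto
    qed
    then obtain b where b: "b > t" "\<forall>s\<in>{t<..<b}\<inter>{0..T}. x s \<le> x t + 1" by auto
    have "\<exists>a<t. \<forall>s\<in>{a<..<t}\<inter>{0..T}. x s \<le> left_limit x t + 1"
    proof (cases "0 < t")
      case True
      then have "(x \<longlongrightarrow> left_limit x t) (at_left t)"
        using tendsto_left_limit[OF assms(1)] t by simp
      then have "eventually (\<lambda>s. x s < left_limit x t + 1) (at_left t)"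
        by (rule order_tendstoD) simp
      then show ?thesis unfolding eventually_at_left_field by fastforce
    next
      case False
      then have "\<forall>s\<in>{t-1<..<t}\<inter>{0..T}. x s \<le> left_limit x t + 1" by auto
      then show ?thesis by (intro exI[of _ "t-1"]) auto
    qed
    then obtain a where a: "a < t" "\<forall>s\<in>{a<..<t}\<inter>{0..T}. x s \<le> left_limit x t + 1" by auto
    show "\<exists>d>0. \<forall>a b. a \<le> t \<and> t \<le> b \<and> b - a < d \<longrightarrow> ?P a b"
    proof (rule exI[of _ "min (t - a) (b - t)"], intro conjI allI impI)
      fix a' b' assume *: "a' \<le> t \<and> t \<le> b' \<and> b' - a' < min (t - a) (b - t)"
      have "x s \<le> max (x t + 1) (left_limit x t + 1)" if s: "s \<in> {a'..b'} \<inter> {0..T}" for s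
      proof -
        consider "s = t" | "s \<in> {t<..<b} \<inter> {0..T}" | "s \<in> {a<..<t} \<inter> {0..T}"
          using s * by (cases s t rule: linorder_cases) auto
        then show ?thesis using a(2) b(2) by cases force+
      qed
      then show "?P a' b'" by blast
    qed (use a b in auto)
  qed
  then show ?thesis by simp
qed

lemma left_limit_le:
  assumes "cadlag T x" "t \<in> {0<..T}" "a < t" "\<And>s. a < s \<Longrightarrow> s < t \<Longrightarrow> x s \<le> C"
  shows "left_limit x t \<le> C"
proof (rule tendsto_upperbound[OF tendsto_left_limit[OF assms(1,2)]])
  show "\<forall>\<^sub>F s in at_left t. x s \<le> C"
    using assms(3,4) eventually_at_left_field by blast
qed simp

lemma left_limit_bounded_above:
  assumes "cadlag T x"
  shows "\<exists>C. \<forall>t\<in>{0<..T}. left_limit x t \<le> C"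
proof (cases "0 \<le> T")
  case True
  then obtain C where C: "\<forall>t\<in>{0..T}. x t \<le> C" using cadlag_bounded_above assms by blast
  have "left_limit x t \<le> C" if "t \<in> {0<..T}" for t
    by (rule left_limit_le[OF assms that, of 0]) (use that C in auto)
  then show ?thesis by blast
qed auto

text \<open>A bound for \<open>x\<close> on an open interval ending at \<open>t\<close> is inherited
  by the left limit at each positive point of the interval. This upper half of left-continuity is
  what the localisation at \<open>t\<close> uses.\<close>

lemma left_limit_upper_semicontinuous_left:
  assumes "cadlag T x" "t \<in> {0<..T}" "0 < e"
  shows "\<exists>\<delta>>0. \<forall>s\<in>{t-\<delta><..t}. 0 < s \<longrightarrow> left_limit x s \<le> left_limit x t + e"
proof -
  have "eventually (\<lambda>s. x s < left_limit x t + e) (at_left t)"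
    by (rule order_tendstoD[OF tendsto_left_limit[OF assms(1,2)]]) (use assms in simp)
  then obtain b where b: "b < t" "\<And>s. b < s \<Longrightarrow> s < t \<Longrightarrow> x s < left_limit x t + e"
    unfolding eventually_at_left_field by auto
  have "left_limit x s \<le> left_limit x t + e" if "s \<in> {b<..t}" "0 < s" for s
    by (rule left_limit_le[OF assms(1), of _ b]) (use assms that b(2) in \<open>auto intro: less_imp_le\<close>)
  with b(1) show ?thesis by (intro exI[of _ "t - b"]) auto
qed

subsection \<open>Running essential suprema\<close>

text \<open>The inequality involves uncountably many times \<open>t\<close> and bounds
  \<open>a\<close>, each with its own null set. Monotonicity in both reduces them to countably
  many.\<close>

lemma AE_le_running_ess_sup:
  fixes h :: "real \<Rightarrow> real"
  shows "AE t in \<mu>. 0 < t \<longrightarrow>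
    ereal (h t) \<le> Inf (ereal ` {a. AE s in \<mu>. s \<in> {0<..t} \<longrightarrow> h s \<le> a})"
proof -
  \<comment> \<open>The times up to which \<open>q\<close> is an essential upper bound of
    \<open>h\<close>. The set is closed downwards and contains every
    \<open>t \<le> 0\<close>.\<close>
  define S where "S q = {t. AE s in \<mu>. s \<in> {0<..t} \<longrightarrow> h s \<le> q}" for q
  have down: "r \<in> S q" if "t \<in> S q" "r \<le> t" for r t q
    using that unfolding S_def by (auto elim!: eventually_mono)
  have ae: "AE s in \<mu>. s \<in> S q \<longrightarrow> 0 < s \<longrightarrow> h s \<le> q" for q
  proof -
    \<comment> \<open>Countably many elements are cofinal in the interval \<open>S q\<close>; its maximum, if any, must be added.\<close>
    define C where "C = (\<rat> \<inter> S q) \<union> ({Sup (S q)} \<inter> S q)"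
    have "countable C" unfolding C_def using countable_rat by auto
    moreover have "AE s in \<mu>. s \<in> {0<..r} \<longrightarrow> h s \<le> q" if "r \<in> C" for r
      using that by (auto simp: C_def S_def)
    ultimately have "AE s in \<mu>. \<forall>r\<in>C. s \<in> {0<..r} \<longrightarrow> h s \<le> q"
      by (subst AE_ball_countable) auto
    then show ?thesis
    proof eventually_elim
      case (elim s)
      show ?case
      proof (intro impI)
        assume s: "s \<in> S q" "0 < s"
        have "\<exists>r\<in>C. s \<le> r"
        proof (cases "\<forall>t\<in>S q. t \<le> s")
          case True
          then have "Sup (S q) = s" using s(1) by (intro cSup_eq_maximum) auto
          with s show ?thesis by (auto simp: C_def)
        next
          case False
          then obtain t where "t \<in> S q" "s < t" by auto
          moreover from Rats_dense_in_real[OF this(2)] obtain r where "r \<in> \<rat>" "s < r" "r < t" by auto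
          ultimately show ?thesis using down[of t q r] by (auto simp: C_def intro!: bexI[of _ r])
        qed
        with elim s show "h s \<le> q" by auto
      qed
    qed
  qed
  have "AE t in \<mu>. \<forall>q\<in>\<rat>. t \<in> S q \<longrightarrow> 0 < t \<longrightarrow> h t \<le> q"
    using ae by (simp add: AE_ball_countable[OF countable_rat])
  then show ?thesis
  proof eventually_elim
    case (elim t)
    show ?case
    proof (intro impI Inf_greatest)
      fix z assume t: "0 < t" and "z \<in> ereal ` {a. AE s in \<mu>. s \<in> {0<..t} \<longrightarrow> h s \<le> a}"
      then obtain a where a: "z = ereal a" "t \<in> S a" by (auto simp: S_def)
      \<comment> \<open>Rational bounds suffice: a rational between \<open>a\<close> and
        \<open>h t\<close> would still be an essential upper bound up to \<open>t\<close>, against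
        the a.e. inequality at rational levels.\<close>
      have "h t \<le> a"
      proof (rule ccontr)
        assume "\<not> h t \<le> a"
        then obtain q where q: "q \<in> \<rat>" "a < q" "q < h t" using Rats_dense_in_real[of a "h t"] by auto
        have "t \<in> S q" using a(2) q(2) unfolding S_def by (auto elim!: eventually_mono)
        with elim q t show False by auto
      qed
      with a show "ereal (h t) \<le> z" by simp
    qed
  qed
qed

lemma INF_running_ess_sup_le:
  fixes f y :: "real \<Rightarrow> real"
  assumes ae: "AE s in \<mu>. s \<in> {0<..t} \<longrightarrow> f s \<le> y s"
    and bdd: "\<And>s. s \<in> {0<..t} \<Longrightarrow> y s \<le> C"
    and usc: "\<And>e. 0 < e \<Longrightarrow> \<exists>\<delta>>0. \<forall>s\<in>{t-\<delta><..t}. 0 < s \<longrightarrow> y s \<le> y t + e"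
  shows "(INF n. - ereal (real n * t) +
      Inf (ereal ` {a. AE s in \<mu>. s \<in> {0<..t} \<longrightarrow> f s + real n * s \<le> a})) \<le> ereal (y t)"
    (is "(INF n. ?G n) \<le> _")
proof (rule ereal_le_epsilon2)
  fix e :: real assume e: "0 < e"
  obtain \<delta> where \<delta>: "\<delta> > 0" "\<And>s. s \<in> {t-\<delta><..t} \<Longrightarrow> 0 < s \<Longrightarrow> y s \<le> y t + e"
    using usc[OF e] by auto
  \<comment> \<open>With \<open>n * \<delta>\<close> above \<open>C - y t\<close>, the penalty at
    distance at least \<open>\<delta>\<close> from \<open>t\<close> outweighs any excess of
    \<open>y\<close> over \<open>y t\<close>; closer to \<open>t\<close>, \<open>usc\<close> gives
    the bound.\<close>
  obtain n :: nat where "(C - y t) / \<delta> < n" using reals_Archimedean2 by blast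
  then have n: "C - y t < n * \<delta>" using \<delta>(1) by (simp add: divide_less_eq)
  have *: "y s + n * s \<le> y t + e + n * t" if s: "s \<in> {0<..t}" for s :: real
  proof (cases "t - \<delta> < s")
    case True
    then have "y s \<le> y t + e" using \<delta>(2) s by simp
    moreover have "n * s \<le> n * t" using s by (simp add: mult_left_mono)
    ultimately show ?thesis by linarith
  next
    case False
    then have "real n * s \<le> n * (t - \<delta>)" by (simp add: mult_left_mono)
    then have "real n * s \<le> n * t - n * \<delta>" by (simp add: right_diff_distrib)
    with bdd[OF s] n e show ?thesis by linarith
  qed
  have "AE s in \<mu>. s \<in> {0<..t} \<longrightarrow> f s + n * s \<le> y t + e + n * t"
    using ae
  proof eventually_elim
    case (elim s)
    with *[of s] show ?case by auto
  qed
  \<comment> \<open>The constant \<open>y t + e + n * t\<close> is an admissible bound; the shift by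
    \<open>- n * t\<close> then leaves \<open>y t + e\<close>.\<close>
  then have "Inf (ereal ` {a. AE s in \<mu>. s \<in> {0<..t} \<longrightarrow> f s + real n * s \<le> a})
      \<le> ereal (y t + e + n * t)"
    by (intro Inf_lower) auto
  then have "?G n \<le> - ereal (real n * t) + ereal (y t + e + n * t)"
    by (intro add_left_mono)
  also have "\<dots> = ereal (y t) + ereal e" by simp
  finally show "(INF n. ?G n) \<le> ereal (y t) + ereal e"
    by (rule INF_lower2[OF UNIV_I])
qed

subsection \<open>The pathwise equivalence\<close>

lemma sets_stieltjes [simp, measurable_cong]: "sets (stieltjes T \<rho> \<omega>) = sets borel"
  and space_stieltjes [simp]: "space (stieltjes T \<rho> \<omega>) = UNIV"
  by (simp_all add: stieltjes_def)

text \<open>The integral of the nonnegative function \<open>max 0 (g s \<omega> + n * s - a)\<close>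
  vanishes iff its integrand does so a.e., that is, iff \<open>a\<close> is an essential upper bound
  on \<open>{0<..t}\<close>.\<close>

lemma g_level_eq_running_ess_sup:
  assumes g: "(\<lambda>s. g s \<omega>) \<in> borel_measurable (restrict_space borel {0<..T})"
    and t: "t \<le> T"
  shows "g_level T \<rho> g n t \<omega> = - ereal (real n * t) +
     Inf (ereal ` {a. AE s in stieltjes T \<rho> \<omega>. s \<in> {0<..t} \<longrightarrow> g s \<omega> + real n * s \<le> a})"
proof -
  let ?S = "stieltjes T \<rho> \<omega>"
  have "(\<integral>\<^sup>+s\<in>{0<..t}. ennreal (max 0 (g s \<omega> + real n * s - a)) \<partial>?S) = 0 \<longleftrightarrow>
      (AE s in ?S. s \<in> {0<..t} \<longrightarrow> g s \<omega> + real n * s \<le> a)" for a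
  proof -
    have [measurable]: "(\<lambda>s. g s \<omega>) \<in> borel_measurable (restrict_space borel {0<..t})"
      by (rule measurable_restrict_mono[OF g]) (use t in auto)
    have [measurable]: "(\<lambda>s. s) \<in> borel_measurable (restrict_space borel {0<..t})"
      by (rule measurable_restrict_space1) simp
    have "(\<lambda>s. ennreal (max 0 (g s \<omega> + real n * s - a))) \<in> borel_measurable (restrict_space borel {0<..t})"
      by measurable
    \<comment> \<open>The path of \<open>g\<close> is measurable only on the interval; the indicator
      extends the integrand by zero to a Borel function on the line.\<close>
    then have "(\<lambda>s. ennreal (max 0 (g s \<omega> + real n * s - a)) * indicator {0<..t} s) \<in> borel_measurable borel"
      by (subst (asm) borel_measurable_restrict_space_iff_ennreal) auto
    then have "(\<lambda>s. ennreal (max 0 (g s \<omega> + real n * s - a)) * indicator {0<..t} s) \<in> borel_measurable ?S"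
      by (simp cong: measurable_cong_sets)
    then have "(\<integral>\<^sup>+s\<in>{0<..t}. ennreal (max 0 (g s \<omega> + real n * s - a)) \<partial>?S) = 0 \<longleftrightarrow>
        (AE s in ?S. ennreal (max 0 (g s \<omega> + real n * s - a)) * indicator {0<..t} s = 0)"
      by (rule nn_integral_0_iff_AE)
    also have "\<dots> \<longleftrightarrow> (AE s in ?S. s \<in> {0<..t} \<longrightarrow> g s \<omega> + real n * s \<le> a)"
      by (intro AE_cong) (auto simp: indicator_def ennreal_eq_0_iff max_def split: if_splits)
    finally show ?thesis .
  qed
  then show ?thesis unfolding g_level_def by simp
qed

lemma pathwise_equivalence:
  assumes g: "(\<lambda>s. g s \<omega>) \<in> borel_measurable (restrict_space borel {0<..T})"
    and y: "cadlag T y"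
  shows "(AE t in stieltjes T \<rho> \<omega>. t \<in> {0<..T} \<longrightarrow> g t \<omega> \<le> left_limit y t) \<longleftrightarrow>
    (\<forall>t\<in>{0<..T}. g_star T \<rho> g t \<omega> \<le> ereal (left_limit y t))" (is "?L \<longleftrightarrow> ?R")
proof
  assume L: ?L
  show ?R
  proof
    fix t assume t: "t \<in> {0<..T}"
    obtain C where C: "\<forall>s\<in>{0<..T}. left_limit y s \<le> C" using left_limit_bounded_above[OF y] by blast
    have "AE s in stieltjes T \<rho> \<omega>. s \<in> {0<..t} \<longrightarrow> g s \<omega> \<le> left_limit y s"
      using L by eventually_elim (use t in auto)
    from INF_running_ess_sup_le[OF this, of C] C t left_limit_upper_semicontinuous_left[OF y t]
    show "g_star T \<rho> g t \<omega> \<le> ereal (left_limit y t)"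
      by (simp add: g_star_def g_level_eq_running_ess_sup[of g \<omega> T, OF g])
  qed
next
  assume R: ?R
  let ?G = "\<lambda>n t. Inf (ereal ` {a. AE s in stieltjes T \<rho> \<omega>. s \<in> {0<..t} \<longrightarrow> g s \<omega> + real n * s \<le> a})"
  \<comment> \<open>Countably many levels \<open>n\<close> share one null set, off which
    \<open>g\<close> lies below every \<open>g_level\<close> and hence below
    \<open>g_star\<close>.\<close>
  have "AE t in stieltjes T \<rho> \<omega>. \<forall>n. 0 < t \<longrightarrow> ereal (g t \<omega> + real n * t) \<le> ?G n t"
    unfolding AE_all_countable by (intro allI AE_le_running_ess_sup)
  then show ?L
  proof eventually_elim
    case (elim t)
    show ?case
    proof
      assume t: "t \<in> {0<..T}"
      have "ereal (g t \<omega>) \<le> g_star T \<rho> g t \<omega>"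
        unfolding g_star_def
      proof (rule INF_greatest)
        fix n
        have "ereal (g t \<omega>) = - ereal (real n * t) + ereal (g t \<omega> + real n * t)" by simp
        also have "\<dots> \<le> - ereal (real n * t) + ?G n t"
          using elim t by (intro add_left_mono) auto
        also have "\<dots> = g_level T \<rho> g n t \<omega>"
          using t g_level_eq_running_ess_sup[of g \<omega> T, OF g] by simp
        finally show "ereal (g t \<omega>) \<le> g_level T \<rho> g n t \<omega>" .
      qed
      also have "\<dots> \<le> ereal (left_limit y t)" using R t by blast
      finally show "g t \<omega> \<le> left_limit y t" by simp
    qed
  qed
qed

subsection \<open>Null sets of the product measure\<close>

text \<open>The extended path is constant on each side of \<open>{0<..T}\<close>, so half-open
  intervals there have measure zero, and countably many of them cover the complement.\<close>

lemma AE_stieltjes_Ioc: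
  assumes "0 \<le> T" "mono_on {0..T} (\<lambda>t. \<rho> t \<omega>)" "cadlag T (\<lambda>t. \<rho> t \<omega>)"
  shows "AE t in stieltjes T \<rho> \<omega>. t \<in> {0<..T}"
proof -
  let ?S = "stieltjes T \<rho> \<omega>"
  have "AE t in ?S. t \<notin> {- real n<..0}" for n
    by (rule AE_not_in) (auto simp: null_sets_def emeasure_stieltjes_Ioc[of T \<rho> \<omega>, OF assms] assms(1))
  moreover have "AE t in ?S. t \<notin> {T<..T + real n}" for n
    by (rule AE_not_in) (auto simp: null_sets_def emeasure_stieltjes_Ioc[of T \<rho> \<omega>, OF assms] assms(1))
  ultimately have "AE t in ?S. \<forall>n. t \<notin> {- real n<..0} \<and> t \<notin> {T<..T + real n}"
    unfolding AE_all_countable by (auto intro: AE_conjI)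
  then show ?thesis
  proof eventually_elim
    case (elim t)
    obtain n where "\<bar>t\<bar> + T < real n" using reals_Archimedean2 by blast
    with elim[rule_format, of n] show ?case using assms(1) by auto
  qed
qed

lemma sets_stieltjes_product [simp]:
  "sets (stieltjes_product M T \<rho>) = sets (borel \<Otimes>\<^sub>M completion M)"
  unfolding stieltjes_product_def
  using sets.space_closed[of "borel \<Otimes>\<^sub>M completion M"] sets.sigma_sets_eq[of "borel \<Otimes>\<^sub>M completion M"]
  by (subst sets_measure_of) (auto simp: space_pair_measure)

text \<open>A Fubini statement for null sets of a kernel product. Measurability is asked only over
  \<open>{0<..T}\<close>, since \<open>g\<close> and the left limits are controlled only there and
  the measure does not charge other times.\<close>

lemma AE_stieltjes_product_iff:
  assumes T: "0 \<le> T" and bm: "brownian_motion M T B"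
    and \<rho>: "\<rho> \<in> class_K T (augmented_filtration M B)"
    and meas: "{x \<in> {0<..T} \<times> space M. \<not> P x} \<in> sets (borel \<Otimes>\<^sub>M completion M)"
  shows "(AE x in stieltjes_product M T \<rho>. P x) \<longleftrightarrow>
    (AE \<omega> in completion M. AE t in stieltjes T \<rho> \<omega>. t \<in> {0<..T} \<longrightarrow> P (t, \<omega>))"
proof -
  let ?N = "completion M" and ?S = "stieltjes T \<rho>" and ?Q = "stieltjes_product M T \<rho>"
  have D: "\<rho> \<in> class_D T (augmented_filtration M B)" using \<rho> by (simp add: class_K_def)
  have path: "mono_on {0..T} (\<lambda>t. \<rho> t \<omega>)" "cadlag T (\<lambda>t. \<rho> t \<omega>)" if "\<omega> \<in> space M" for \<omega>
    using \<rho> that by (auto simp: class_K_def class_D_def)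
  have slice: "(\<lambda>\<omega>. emeasure (?S \<omega>) {t. (t, \<omega>) \<in> A}) \<in> borel_measurable ?N"
    if "A \<in> sets (borel \<Otimes>\<^sub>M ?N)" for A
    using path class_D_measurable[OF bm D] that by (intro measurable_stieltjes_slice[OF T]) auto
  \<comment> \<open>The measure of \<open>A\<close> is the integral of its nonnegative slice
    measures, so it is zero iff almost every slice is null.\<close>
  have null: "A \<in> null_sets ?Q \<longleftrightarrow> (AE \<omega> in ?N. AE t in ?S \<omega>. (t, \<omega>) \<notin> A)"
    if A: "A \<in> sets (borel \<Otimes>\<^sub>M ?N)" for A
  proof -
    have "A \<in> null_sets ?Q \<longleftrightarrow> (AE \<omega> in ?N. emeasure (?S \<omega>) {t. (t, \<omega>) \<in> A} = 0)"
      using A by (simp add: null_sets_def emeasure_stieltjes_product[OF T bm \<rho> A]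
          nn_integral_0_iff_AE[OF slice[OF A]])
    also have "\<dots> \<longleftrightarrow> (AE \<omega> in ?N. AE t in ?S \<omega>. (t, \<omega>) \<notin> A)"
    proof (rule AE_cong)
      fix \<omega>
      have "{t. (t, \<omega>) \<in> A} \<in> sets (?S \<omega>)"
        using sets_Pair2[OF A, of \<omega>] by (simp add: vimage_def)
      then show "emeasure (?S \<omega>) {t. (t, \<omega>) \<in> A} = 0 \<longleftrightarrow> (AE t in ?S \<omega>. (t, \<omega>) \<notin> A)"
        by (subst AE_iff_measurable[of "{t. (t, \<omega>) \<in> A}"]) auto
    qed
    finally show ?thesis .
  qed
  have space: "space ?Q = UNIV \<times> space M"
    using sets_eq_imp_space_eq[OF sets_stieltjes_product[of M T \<rho>]] by (simp add: space_pair_measure)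
  have ioc: "AE x in ?Q. fst x \<in> {0<..T}"
  proof -
    have m: "(- {0<..T}) \<times> space M \<in> sets (borel \<Otimes>\<^sub>M ?N)"
      using sets.top[of ?N] by (intro pair_measureI) auto
    have "AE \<omega> in ?N. AE t in ?S \<omega>. (t, \<omega>) \<notin> (- {0<..T}) \<times> space M"
    proof (rule AE_I2)
      fix \<omega> assume "\<omega> \<in> space ?N"
      then have "AE t in ?S \<omega>. t \<in> {0<..T}"
        by (intro AE_stieltjes_Ioc T path) auto
      then show "AE t in ?S \<omega>. (t, \<omega>) \<notin> (- {0<..T}) \<times> space M"
        by eventually_elim auto
    qed
    then have "AE x in ?Q. x \<notin> (- {0<..T}) \<times> space M"
      using null[OF m] AE_not_in by blast
    then show ?thesis by (rule AE_mp) (auto intro!: AE_I2 simp: space)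
  qed
  let ?A = "{x \<in> {0<..T} \<times> space M. \<not> P x}"
  \<comment> \<open>Where \<open>P\<close> fails outside \<open>?A\<close>, the time is not in
    \<open>{0<..T}\<close>, and \<open>ioc\<close> discards such points.\<close>
  have "(AE x in ?Q. P x) \<longleftrightarrow> (AE x in ?Q. x \<notin> ?A)"
  proof
    assume "AE x in ?Q. x \<notin> ?A"
    with ioc AE_space show "AE x in ?Q. P x"
      by eventually_elim (auto simp: space)
  qed (auto elim!: eventually_mono)
  also have "\<dots> \<longleftrightarrow> ?A \<in> null_sets ?Q"
    using AE_iff_null_sets[of ?A ?Q] meas by simp
  also have "\<dots> \<longleftrightarrow> (AE \<omega> in ?N. AE t in ?S \<omega>. (t, \<omega>) \<notin> ?A)"
    by (rule null[OF meas])
  also have "\<dots> \<longleftrightarrow> (AE \<omega> in ?N. AE t in ?S \<omega>. t \<in> {0<..T} \<longrightarrow> P (t, \<omega>))"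
    by (intro AE_cong) auto
  finally show ?thesis .
qed

subsection \<open>Joint measurability\<close>

lemma sets_augmented_filtration_completion:
  assumes "brownian_motion M T B" "t \<le> T"
  shows "sets (augmented_filtration M B t) \<subseteq> sets (completion M)"
  using assms by (intro sets_augmented_filtration_subset) (auto simp: brownian_motion_def)

text \<open>Serves to evaluate a predictable process at the earlier time \<open>t - c\<close>,
  clamped to \<open>[0,T]\<close>. Each predictable generator is a rectangle in the completed
  product \<sigma>-algebra, because every \<open>F s\<close> with \<open>s \<le> T\<close> lies in
  the completion.\<close>

lemma measurable_clamp_predictable:
  fixes c :: real
  assumes bm: "brownian_motion M T B" and T: "0 \<le> T"
  shows "(\<lambda>(t, \<omega>). (max 0 (min T (t - c)), \<omega>)) \<in>
    measurable (borel \<Otimes>\<^sub>M completion M) (predictable_algebra T (augmented_filtration M B))"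
proof -
  let ?F = "augmented_filtration M B" and ?N = "completion M"
  let ?G = "{{0} \<times> A | A. A \<in> sets (?F 0)} \<union>
        {{s<..t} \<times> A | s t A. 0 \<le> s \<and> s < t \<and> t \<le> T \<and> A \<in> sets (?F s)}"
  let ?f = "\<lambda>(t, \<omega>). (max 0 (min T (t - c)), \<omega>)"
  have f: "?f \<in> measurable (borel \<Otimes>\<^sub>M ?N) (borel \<Otimes>\<^sub>M ?N)" by measurable
  have G: "?G \<subseteq> Pow ({0..T} \<times> space M)"
    using sets.sets_into_space[of _ "?F _"] T by fastforce
  show ?thesis
    unfolding predictable_algebra_def space_augmented_filtration
  proof (rule measurable_measure_of[OF G])
    show "?f \<in> space (borel \<Otimes>\<^sub>M ?N) \<rightarrow> {0..T} \<times> space M"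
      using T by (auto simp: space_pair_measure)
  next
    fix A assume "A \<in> ?G"
    then have "\<exists>s I C. A = I \<times> C \<and> I \<in> sets borel \<and> s \<le> T \<and> C \<in> sets (?F s)"
    proof
      assume "A \<in> {{0} \<times> A | A. A \<in> sets (?F 0)}"
      then obtain C where "A = {0} \<times> C" "C \<in> sets (?F 0)" by auto
      moreover have "{0::real} \<in> sets borel" by simp
      ultimately show ?thesis using T by blast
    next
      assume "A \<in> {{s<..t} \<times> A | s t A. 0 \<le> s \<and> s < t \<and> t \<le> T \<and> A \<in> sets (?F s)}"
      then obtain s t C where "A = {s<..t} \<times> C" "s \<le> T" "C \<in> sets (?F s)" by auto
      moreover have "{s<..t} \<in> sets borel" by simp
      ultimately show ?thesis by blast
    qed
    with sets_augmented_filtration_completion[OF bm] have "A \<in> sets (borel \<Otimes>\<^sub>M ?N)"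
      by (blast intro: pair_measureI)
    then show "?f -` A \<inter> space (borel \<Otimes>\<^sub>M ?N) \<in> sets (borel \<Otimes>\<^sub>M ?N)"
      by (rule measurable_sets[OF f])
  qed
qed

text \<open>The left limit is the pointwise limit of \<open>Y\<close> at the times
  \<open>t - 1/(n+1)\<close>, clamped to \<open>[0,T]\<close>, and each of these functions is
  jointly measurable.\<close>

lemma left_limit_joint_measurable:
  assumes bm: "brownian_motion M T B" and T: "0 \<le> T"
    and Y: "Y \<in> class_D T (augmented_filtration M B)"
  shows "(\<lambda>(t, \<omega>). left_limit (\<lambda>s. Y s \<omega>) t) \<in>
    borel_measurable (restrict_space (borel \<Otimes>\<^sub>M completion M) ({0<..T} \<times> space M))"
proof -
  let ?R = "restrict_space (borel \<Otimes>\<^sub>M completion M) ({0<..T} \<times> space M)"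
  let ?Z = "\<lambda>n (t, \<omega>). Y (max 0 (min T (t - 1 / real (Suc n)))) \<omega>"
  have Z: "?Z n \<in> borel_measurable ?R" for n
  proof -
    have "(\<lambda>(t, \<omega>). Y t \<omega>) \<in> borel_measurable (predictable_algebra T (augmented_filtration M B))"
      using Y by (simp add: class_D_def)
    from measurable_compose[OF measurable_clamp_predictable[OF bm T, of "1 / real (Suc n)"] this]
    have "?Z n \<in> borel_measurable (borel \<Otimes>\<^sub>M completion M)"
      by (simp add: case_prod_beta')
    then show ?thesis by (rule measurable_restrict_space1)
  qed
  show ?thesis
  proof (rule borel_measurable_LIMSEQ_metric[OF Z])
    fix p assume "p \<in> space ?R"
    then obtain t \<omega> where p: "p = (t, \<omega>)" "t \<in> {0<..T}" "\<omega> \<in> space M"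
      by (auto simp: space_restrict_space)
    have "((\<lambda>s. Y s \<omega>) \<longlongrightarrow> left_limit (\<lambda>s. Y s \<omega>) t) (at_left t)"
      using Y p by (intro tendsto_left_limit) (auto simp: class_D_def)
    moreover have "filterlim (\<lambda>n. max 0 (min T (t - 1 / real (Suc n)))) (at_left t) sequentially"
      unfolding filterlim_at
    proof
      have "t - 1 / real (Suc n) < t" for n by simp
      \<comment> \<open>Convergence along \<open>at_left t\<close> needs times strictly below
        \<open>t\<close>; clamping at 0 respects this because \<open>t > 0\<close>.\<close>
      then have "max 0 (min T (t - 1 / real (Suc n))) < t" for n
        using p(2) by (auto simp: min_less_iff_disj simp del: of_nat_Suc)
      then show "\<forall>\<^sub>F n in sequentially. max 0 (min T (t - 1 / real (Suc n))) \<in> {..<t} \<and>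
          max 0 (min T (t - 1 / real (Suc n))) \<noteq> t"
        by (intro always_eventually) (auto simp: less_le)
      have "(\<lambda>n. max 0 (min T (t - 1 / real (Suc n)))) \<longlonglongrightarrow> max 0 (min T (t - 0))"
        by (intro tendsto_intros LIMSEQ_Suc[OF lim_1_over_n])
      then show "(\<lambda>n. max 0 (min T (t - 1 / real (Suc n)))) \<longlonglongrightarrow> t"
        using p(2) by simp
    qed
    ultimately show "(\<lambda>n. ?Z n p) \<longlonglongrightarrow> (case p of (t, \<omega>) \<Rightarrow> left_limit (\<lambda>s. Y s \<omega>) t)"
      using p(1) by (auto dest: filterlim_compose)
  qed
qed

text \<open>Progressive measurability at the terminal time \<open>T\<close> already covers all of
  \<open>{0<..T}\<close>, and the \<sigma>-algebra at time \<open>T\<close> is contained in the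
  completion.\<close>

lemma progressively_measurable_joint_measurable:
  assumes bm: "brownian_motion M T B" and T: "0 < T"
    and g: "progressively_measurable T (augmented_filtration M B) g"
  shows "(\<lambda>(t, \<omega>). g t \<omega>) \<in>
    borel_measurable (restrict_space (borel \<Otimes>\<^sub>M completion M) ({0<..T} \<times> space M))"
proof -
  let ?R = "restrict_space (borel \<Otimes>\<^sub>M completion M) ({0<..T} \<times> space M)"
  let ?F = "augmented_filtration M B T"
  have "fst \<in> measurable ?R (restrict_space borel {0<..T})"
    by (intro measurable_restrict_space2 measurable_restrict_space1 measurable_fst)
      (auto simp: space_restrict_space)
  moreover have "snd \<in> measurable ?R ?F"
  proof -
    have "snd \<in> measurable ?R (completion M)"
      by (intro measurable_restrict_space1 measurable_snd)
    then show ?thesis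
      using sets_augmented_filtration_completion[OF bm order_refl] by (auto simp: measurable_def)
  qed
  ultimately have "(\<lambda>x. (fst x, snd x)) \<in> measurable ?R (restrict_space borel {0<..T} \<Otimes>\<^sub>M ?F)"
    by (rule measurable_Pair)
  moreover have "(\<lambda>(t, \<omega>). g t \<omega>) \<in> borel_measurable (restrict_space borel {0<..T} \<Otimes>\<^sub>M ?F)"
    using g T by (simp add: progressively_measurable_def)
  ultimately show ?thesis
    by (auto dest: measurable_compose)
qed

lemma progressively_measurable_path:
  assumes "progressively_measurable T F g" "0 < T" "\<omega> \<in> space (F T)"
  shows "(\<lambda>s. g s \<omega>) \<in> borel_measurable (restrict_space borel {0<..T})"
proof -
  have "(\<lambda>(t, \<omega>). g t \<omega>) \<in> borel_measurable (restrict_space borel {0<..T} \<Otimes>\<^sub>M F T)"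
    using assms by (simp add: progressively_measurable_def)
  from measurable_compose[OF measurable_Pair2'[OF assms(3)] this] show ?thesis by simp
qed

section \<open>From single paths to the product measure\<close>

theorem corollary7p1:
  fixes M :: "'a measure" and T :: real
    and B :: "real \<Rightarrow> 'a \<Rightarrow> 'b::euclidean_space"
    and g \<rho> Y :: "real \<Rightarrow> 'a \<Rightarrow> real"
  assumes "prob_space M" and "0 < T"
    and "brownian_motion M T B"
    and "progressively_measurable T (augmented_filtration M B) g"
    and "\<rho> \<in> class_K T (augmented_filtration M B)"
    and "Y \<in> class_D T (augmented_filtration M B)"
  shows "(AE (t, \<omega>) in stieltjes_product M T \<rho>. g t \<omega> \<le> left_limit (\<lambda>s. Y s \<omega>) t) \<longleftrightarrow>
         (AE \<omega> in M. \<forall>t\<in>{0<..T}. g_star T \<rho> g t \<omega> \<le> ereal (left_limit (\<lambda>s. Y s \<omega>) t))"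
proof -
  let ?N = "borel \<Otimes>\<^sub>M completion M" and ?D = "{0<..T} \<times> space M"
  let ?P = "\<lambda>(t, \<omega>). g t \<omega> \<le> left_limit (\<lambda>s. Y s \<omega>) t"
  have T: "0 \<le> T" using assms(2) by simp
  have "?D \<in> sets ?N"
    using sets.top[of "completion M"] by (intro pair_measureI) auto
  then have D: "?D \<inter> space ?N \<in> sets ?N" by (metis sets.Int sets.top)
  \<comment> \<open>The exceptional set is measurable in the trace \<sigma>-algebra on
    \<open>?D\<close>, hence in the product, since \<open>?D\<close> itself is measurable.\<close>
  have "{x \<in> space (restrict_space ?N ?D). \<not> ?P x} \<in> sets (restrict_space ?N ?D)"
    using borel_measurable_less[OF left_limit_joint_measurable[OF assms(3) T assms(6)]
        progressively_measurable_joint_measurable[OF assms(3,2,4)]]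
    by (simp add: case_prod_beta' not_le)
  also have "{x \<in> space (restrict_space ?N ?D). \<not> ?P x} = {x \<in> ?D. \<not> ?P x}"
    by (auto simp: space_restrict_space space_pair_measure)
  finally have "{x \<in> ?D. \<not> ?P x} \<in> sets ?N"
    by (simp add: sets_restrict_space_iff[OF D])
  from AE_stieltjes_product_iff[OF T assms(3,5) this]
  have "(AE x in stieltjes_product M T \<rho>. ?P x) \<longleftrightarrow>
      (AE \<omega> in completion M. AE t in stieltjes T \<rho> \<omega>.
        t \<in> {0<..T} \<longrightarrow> g t \<omega> \<le> left_limit (\<lambda>s. Y s \<omega>) t)"
    by simp
  also have "\<dots> \<longleftrightarrow> (AE \<omega> in completion M.
      \<forall>t\<in>{0<..T}. g_star T \<rho> g t \<omega> \<le> ereal (left_limit (\<lambda>s. Y s \<omega>) t))"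
  \<comment> \<open>The two conditions agree for every \<open>\<omega>\<close>, so no exceptional
    set of paths arises here.\<close>
  proof (rule AE_cong)
    fix \<omega> assume "\<omega> \<in> space (completion M)"
    then show "(AE t in stieltjes T \<rho> \<omega>. t \<in> {0<..T} \<longrightarrow> g t \<omega> \<le> left_limit (\<lambda>s. Y s \<omega>) t) \<longleftrightarrow>
        (\<forall>t\<in>{0<..T}. g_star T \<rho> g t \<omega> \<le> ereal (left_limit (\<lambda>s. Y s \<omega>) t))"
      using assms(6) progressively_measurable_path[OF assms(4,2)]
      by (intro pathwise_equivalence) (auto simp: class_D_def)
  qed
  \<comment> \<open>The path condition need not define a set in \<open>M\<close>; a.e. statements
    for \<open>M\<close> and its completion agree because both only ask for a covering null
    set.\<close>
  finally show ?thesis by (simp add: AE_completion_iff)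
qed

end
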